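(* For all integers $n\ge k\ge 0$ and every nonnegative integer $r$, \[ S_{2,\lambda}^{(r,Y)}(n+r,k+r)=\frac{1}{k!}\sum_{j=0}^{k}\binom{k}{j}(-1)^{k-j}E\big[(S_{j+r})_{n,\lambda}\big]. \]
   Context: Let $\lambda$ be a nonzero real number. Define $(x)_{0,\lambda}=1$ and $(x)_{n,\lambda}=x(x-\lambda)\cdots(x-(n-1)\lambda)$ for $n\ge1$, and the degenerate exponential $e_{\lambda}^{x}(t)=(1+\lambda t)^{x/\lambda}=\sum_{n\ge0}(x)_{n,\lambda}\frac{t^n}{n!}$. Let $Y$ be a random variable whose moment generating function $E[e^{tY}]$ exists in a neighborhood of the origin, let $(Y_j)_{j\ge1}$ be mutually independent copies of $Y$, and set $S_0=0$, $S_k=Y_1+\cdots+Y_k$ for $k\ge1$. For $r$ a nonnegative integer, the probabilistic degenerate $r$-Stirling numbers of the second kind associated with $Y$ are defined by \[ \frac{1}{k!}\Big(E\big[e_{\lambda}^{Y}(t)\big]-1\Big)^{k}E\big[e_{\lambda}^{S_r}(t)\big]=\sum_{n=k}^{\infty}S_{2,\lambda}^{(r,Y)}(n+r,k+r)\frac{t^n}{n!},\quad(k\ge0). \] *)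

theory Defs
  imports "HOL-Probability.Probability"
begin

definition deg_ffact :: "real \<Rightarrow> real \<Rightarrow> nat \<Rightarrow> real" where
  "deg_ffact lam x n = (\<Prod>i<n. x - real i * lam)"

(* Only used for t near 0, where 1 + lam * t > 0. *)
definition deg_exp :: "real \<Rightarrow> real \<Rightarrow> real \<Rightarrow> real" where
  "deg_exp lam x t = (1 + lam * t) powr (x / lam)"

definition mgf_near_zero :: "'a measure \<Rightarrow> ('a \<Rightarrow> real) \<Rightarrow> bool" where
  "mgf_near_zero M Y \<longleftrightarrow>
     (\<exists>\<epsilon>>0. \<forall>t. \<bar>t\<bar> < \<epsilon> \<longrightarrow> integrable M (\<lambda>\<omega>. exp (t * Y \<omega>)))"

(* The index set is {1..}; the value Yc 0 is irrelevant. *)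
definition indep_copies :: "'a measure \<Rightarrow> ('a \<Rightarrow> real) \<Rightarrow> (nat \<Rightarrow> 'a \<Rightarrow> real) \<Rightarrow> bool" where
  "indep_copies M Y Yc \<longleftrightarrow>
     prob_space.indep_vars M (\<lambda>_. borel) Yc {1..} \<and>
     (\<forall>j\<ge>1. distr M borel (Yc j) = distr M borel Y)"

definition partial_sum :: "(nat \<Rightarrow> 'a \<Rightarrow> real) \<Rightarrow> nat \<Rightarrow> 'a \<Rightarrow> real" where
  "partial_sum Yc k \<omega> = (\<Sum>j=1..k. Yc j \<omega>)"

definition prob_deg_rStirling2_gf ::
    "'a measure \<Rightarrow> ('a \<Rightarrow> real) \<Rightarrow> (nat \<Rightarrow> 'a \<Rightarrow> real) \<Rightarrow> real \<Rightarrow> nat \<Rightarrow> nat \<Rightarrow> real \<Rightarrow> real" where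
  "prob_deg_rStirling2_gf M Y Yc lam r k t =
     1 / fact k * ((\<integral>\<omega>. deg_exp lam (Y \<omega>) t \<partial>M) - 1) ^ k *
       (\<integral>\<omega>. deg_exp lam (partial_sum Yc r \<omega>) t \<partial>M)"

(* The coefficients a in the expansion f t = (SUM n >= k. a n * t^n / n!), valid for all real t
   in a neighbourhood of 0.  The series does not mention a n for n < k; these are set to 0, so that
   the sequence is unique whenever such an expansion exists. *)
definition egf_coeffs_from :: "nat \<Rightarrow> (real \<Rightarrow> real) \<Rightarrow> nat \<Rightarrow> real" where
  "egf_coeffs_from k f =
     (THE a. (\<forall>n<k. a n = 0) \<and>
        (\<forall>\<^sub>F t in nhds 0. (\<lambda>i. a (k + i) * t ^ (k + i) / fact (k + i)) sums f t))"

(* Both arguments m = n + r and l = k + r carry the shift by r; meaningful for m, l >= r only. *)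
definition prob_deg_rStirling2 ::
    "'a measure \<Rightarrow> ('a \<Rightarrow> real) \<Rightarrow> (nat \<Rightarrow> 'a \<Rightarrow> real) \<Rightarrow> real \<Rightarrow> nat \<Rightarrow> nat \<Rightarrow> nat \<Rightarrow> real" where
  "prob_deg_rStirling2 M Y Yc lam r m l =
     egf_coeffs_from (l - r) (prob_deg_rStirling2_gf M Y Yc lam r (l - r)) (m - r)"

end

theory Submission
  imports Defs "HOL-Complex_Analysis.Laurent_Convergence"
begin

text \<open>
  Writing \<open>e\<^sub>\<lambda>\<^sup>x(t) = exp (s x)\<close> with \<open>s = ln (1 + \<lambda> t) / \<lambda>\<close>, independence gives
  \<open>E[e\<^sub>\<lambda>\<^sup>S(t)] = \<phi>(t)\<^sup>m\<close> for \<open>S = S\<^sub>m\<close>, where \<open>\<phi>(t) = E[e\<^sub>\<lambda>\<^sup>Y(t)]\<close>.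
  The exponential moments of \<open>S\<^sub>m\<close> allow the binomial series to be integrated termwise, so
  \<open>\<phi>\<^sup>m\<close> is near 0 the exponential generating function of \<open>E[(S\<^sub>m)\<^sub>n\<^sub>,\<^sub>\<lambda>]\<close>.
  The theorem follows by comparing coefficients in the binomial expansion of \<open>(\<phi> - 1)\<^sup>k \<phi>\<^sup>r / k!\<close>;
  since \<open>\<phi> - 1\<close> has no constant term, this power series starts at \<open>t\<^sup>k\<close>.
\<close>

section \<open>Real power series expansions and their coefficients\<close>

text \<open>Zeros of a nonzero power series are isolated, whereas the difference of two expansions
  of \<open>f\<close> sums to 0 on a whole neighbourhood of 0.\<close>

lemma fps_expansion_unique_real:
  fixes f :: "real \<Rightarrow> real"
  assumes "f has_fps_expansion F" "f has_fps_expansion G"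
  shows "F = G"
proof (rule ccontr)
  assume "F \<noteq> G"
  define D where "D = F - G"
  have "(\<lambda>x. f x - f x) has_fps_expansion D"
    unfolding D_def by (intro has_fps_expansion_diff assms)
  then have rad: "fps_conv_radius D > 0" and ev: "\<forall>\<^sub>F z in nhds 0. eval_fps D z = 0"
    by (auto simp: has_fps_expansion_def)
  have D0: "fps_nth D 0 = 0"
    using eventually_nhds_x_imp_x[OF ev] by (simp add: eval_fps_at_0)
  obtain m where m: "fps_nth D m \<noteq> 0"
    using \<open>F \<noteq> G\<close> by (auto simp: D_def fps_eq_iff)
  obtain r where r: "0 < r" "ereal r < fps_conv_radius D"
    using ereal_dense2[OF rad] by (auto simp: zero_ereal_def)
  have sums: "(\<lambda>n. fps_nth D n * (x - 0) ^ n) sums eval_fps D x" if "norm (x - 0) < r" for x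
  proof -
    have "ereal (norm x) < fps_conv_radius D"
      using that r(2) by (metis diff_zero ereal_less(2) less_ereal.simps(1) order.strict_trans)
    from sums_eval_fps[OF this] show ?thesis by simp
  qed
  have "eval_fps D 0 = 0" using D0 by (simp add: eval_fps_at_0)
  moreover have "m > 0" using D0 m by (cases m) auto
  ultimately obtain s where s: "0 < s" "\<And>z. z \<in> cball 0 s - {0} \<Longrightarrow> eval_fps D z \<noteq> 0"
    using powser_0_nonzero[OF r(1) sums _ m] by blast
  obtain d where d: "d > 0" "\<And>z. dist z 0 < d \<Longrightarrow> eval_fps D z = 0"
    using ev by (auto simp: eventually_nhds_metric)
  \<comment> \<open>A nonzero point lying both in the punctured ball without zeros and in the ball
    where \<open>D\<close> sums to 0.\<close>
  define z where "z = min s (d / 2)"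
  have "z > 0" "z \<le> s" "z < d" using s(1) d(1) by (auto simp: z_def min_def)
  then show False using s(2)[of z] d(2)[of z] by simp
qed

text \<open>Convergence at the single point \<open>d / 2\<close> already forces a positive radius of
  convergence.\<close>

lemma has_fps_expansion_sumsI:
  fixes f :: "real \<Rightarrow> real"
  assumes "\<forall>\<^sub>F t in nhds 0. (\<lambda>n. a n * t ^ n) sums f t"
  shows "f has_fps_expansion Abs_fps a"
proof -
  obtain d where d: "d > 0" "\<And>t. dist t 0 < d \<Longrightarrow> (\<lambda>n. a n * t ^ n) sums f t"
    using assms by (auto simp: eventually_nhds_metric)
  have "summable (\<lambda>n. a n * (d / 2) ^ n)"
    using d(2)[of "d / 2"] d(1) by (auto simp: sums_iff)
  from conv_radius_geI[OF this] have "ereal (d / 2) \<le> conv_radius a"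
    using d(1) by simp
  moreover have "0 < ereal (d / 2)" using d(1) by simp
  ultimately have "0 < conv_radius a" by (rule less_le_trans[rotated])
  moreover have "\<forall>\<^sub>F t in nhds 0. eval_fps (Abs_fps a) t = f t"
    using assms by eventually_elim (simp add: eval_fps_def sums_iff)
  ultimately show ?thesis
    by (simp add: has_fps_expansion_def fps_conv_radius_def)
qed

lemma has_fps_expansion_imp_sums:
  fixes f :: "real \<Rightarrow> real"
  assumes "f has_fps_expansion F"
  shows "\<forall>\<^sub>F t in nhds 0. (\<lambda>n. fps_nth F n * t ^ n) sums f t"
proof -
  have "\<forall>\<^sub>F t in nhds (0::real). t \<in> eball 0 (fps_conv_radius F)"
    using assms by (intro eventually_nhds_in_open) (auto simp: has_fps_expansion_def zero_ereal_def)
  moreover have "\<forall>\<^sub>F t in nhds 0. eval_fps F t = f t"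
    using assms by (simp add: has_fps_expansion_def)
  ultimately show ?thesis
  proof eventually_elim
    case (elim t)
    then show ?case using sums_eval_fps[of t F] by (simp add: in_eball_iff)
  qed
qed

text \<open>This discharges the definite description: since the first \<open>k\<close> coefficients
  vanish, the series from \<open>k\<close> on is a full power series, and full expansions are
  unique.\<close>

lemma egf_coeffs_from_eqI:
  assumes F: "f has_fps_expansion F" and low: "\<And>n. n < k \<Longrightarrow> fps_nth F n = 0"
  shows "egf_coeffs_from k f = (\<lambda>n. fact n * fps_nth F n)"
  unfolding egf_coeffs_from_def
proof (rule the_equality)
  have shift: "(\<lambda>i. a (k + i) * t ^ (k + i) / fact (k + i)) sums f t \<longleftrightarrow>
      (\<lambda>n. a n / fact n * t ^ n) sums f t" if "\<forall>n<k. a n = 0" for a t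
    using that sums_zero_iff_shift[of k "\<lambda>n. a n / fact n * t ^ n" "f t"]
    by (simp add: add.commute)
  show "(\<forall>n<k. fact n * fps_nth F n = 0) \<and> (\<forall>\<^sub>F t in nhds 0.
      (\<lambda>i. fact (k + i) * fps_nth F (k + i) * t ^ (k + i) / fact (k + i)) sums f t)"
    using has_fps_expansion_imp_sums[OF F] shift[of "\<lambda>n. fact n * fps_nth F n"] low by simp
  fix a assume a: "(\<forall>n<k. a n = 0) \<and>
      (\<forall>\<^sub>F t in nhds 0. (\<lambda>i. a (k + i) * t ^ (k + i) / fact (k + i)) sums f t)"
  then have "\<forall>\<^sub>F t in nhds 0. (\<lambda>n. a n / fact n * t ^ n) sums f t"
    using shift[of a] by simp
  from fps_expansion_unique_real[OF F has_fps_expansion_sumsI[OF this]]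
  show "a = (\<lambda>n. fact n * fps_nth F n)" by (simp add: fun_eq_iff)
qed

section \<open>Degenerate exponentials and their expectations\<close>

lemma deg_ffact_gbinomial:
  assumes "lam \<noteq> 0"
  shows "deg_ffact lam x n / fact n = lam ^ n * (x / lam gchoose n)"
proof -
  have "deg_ffact lam x n = (\<Prod>i<n. lam * (x / lam - real i))"
    unfolding deg_ffact_def using assms by (intro prod.cong) (auto simp: field_simps)
  also have "\<dots> = lam ^ n * (\<Prod>i = 0..<n. x / lam - real i)"
    by (simp add: prod.distrib lessThan_atLeast0)
  finally show ?thesis by (simp add: gbinomial_prod_rev)
qed

lemma deg_exp_sums:
  assumes "lam \<noteq> 0" "\<bar>lam * t\<bar> < 1"
  shows "(\<lambda>n. deg_ffact lam x n / fact n * t ^ n) sums deg_exp lam x t"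
  using gen_binomial_real[OF assms(2), of "x / lam"] assms(1)
  by (simp add: deg_ffact_gbinomial deg_exp_def power_mult_distrib mult_ac)

text \<open>Each factor satisfies \<bar>x - i lam\<bar> \<le> \<bar>x\<bar> + i \<bar>lam\<bar>. The
  parameter \<open>- \<bar>lam\<bar>\<close> makes the bound itself a degenerate factorial, so the
  majorant of the binomial series is again a degenerate exponential series.\<close>

lemma abs_deg_ffact_le:
  "\<bar>deg_ffact lam x n\<bar> \<le> deg_ffact (- \<bar>lam\<bar>) \<bar>x\<bar> n"
  unfolding deg_ffact_def abs_prod
  by (intro prod_mono) (auto simp: abs_mult intro: order.trans[OF abs_triangle_ineq4])

lemma deg_exp_eq_exp:
  assumes "0 < 1 + lam * t"
  shows "deg_exp lam x t = exp (ln (1 + lam * t) / lam * x)"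
  using assms by (simp add: deg_exp_def powr_def)

text \<open>Both quantities are continuous in \<open>t\<close> and vanish at 0. The first bound
  gives convergence of the binomial series, the second keeps the exponent where the moment
  generating function exists.\<close>

lemma eventually_ln_less:
  fixes lam d :: real
  assumes "d > 0" "lam \<noteq> 0"
  shows "\<forall>\<^sub>F t in nhds 0. \<bar>lam * t\<bar> < 1 \<and> \<bar>ln (1 + lam * t) / lam\<bar> < d"
proof (rule eventually_conj)
  have "isCont (\<lambda>t. \<bar>lam * t\<bar>) 0" "isCont (\<lambda>t. \<bar>ln (1 + lam * t) / lam\<bar>) 0"
    using assms by (auto intro!: continuous_intros)
  then have "((\<lambda>t. \<bar>lam * t\<bar>) \<longlongrightarrow> 0) (nhds 0)"
    "((\<lambda>t. \<bar>ln (1 + lam * t) / lam\<bar>) \<longlongrightarrow> 0) (nhds 0)"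
    by (auto simp: isCont_def tendsto_nhds_iff)
  then show "\<forall>\<^sub>F t in nhds 0. \<bar>lam * t\<bar> < 1"
    "\<forall>\<^sub>F t in nhds 0. \<bar>ln (1 + lam * t) / lam\<bar> < d"
    using order_tendstoD(2) assms(1) zero_less_one by blast+
qed

lemma integral_deg_exp_has_fps_expansion:
  assumes lam: "lam \<noteq> 0" and X[measurable]: "X \<in> borel_measurable M" and "mgf_near_zero M X"
  shows "(\<lambda>t. \<integral>\<omega>. deg_exp lam (X \<omega>) t \<partial>M) has_fps_expansion
    Abs_fps (\<lambda>n. (\<integral>\<omega>. deg_ffact lam (X \<omega>) n \<partial>M) / fact n)"
proof (rule has_fps_expansion_sumsI)
  obtain d where d: "d > 0" "\<And>s. \<bar>s\<bar> < d \<Longrightarrow> integrable M (\<lambda>\<omega>. exp (s * X \<omega>))"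
    using assms(3) by (auto simp: mgf_near_zero_def)
  have meas[measurable]: "(\<lambda>x. deg_ffact lam x n) \<in> borel_measurable borel"
    "(\<lambda>x. deg_exp lam x t) \<in> borel_measurable borel" for n t
    unfolding deg_ffact_def deg_exp_def by measurable
  \<comment> \<open>The neighbourhood is chosen for the parameter of the majorant; as \<bar>-
    \<bar>lam\<bar> t\<bar> = \<bar>lam t\<bar>, the original series converges there too.\<close>
  have "\<forall>\<^sub>F t in nhds 0. \<bar>- \<bar>lam\<bar> * t\<bar> < 1 \<and> \<bar>ln (1 + - \<bar>lam\<bar> * t) / - \<bar>lam\<bar>\<bar> < d"
    using lam d(1) by (intro eventually_ln_less) auto
  then obtain e where e: "e > 0"
    "\<And>t. \<bar>t\<bar> < e \<Longrightarrow> \<bar>- \<bar>lam\<bar> * t\<bar> < 1 \<and> \<bar>ln (1 + - \<bar>lam\<bar> * t) / - \<bar>lam\<bar>\<bar> < d"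
    by (auto simp: eventually_nhds_metric)
  show "\<forall>\<^sub>F t in nhds 0. (\<lambda>n. (\<integral>\<omega>. deg_ffact lam (X \<omega>) n \<partial>M) / fact n * t ^ n) sums
      (\<integral>\<omega>. deg_exp lam (X \<omega>) t \<partial>M)"
    unfolding eventually_nhds_metric
  proof (intro exI[of _ e] conjI allI impI)
    fix t :: real assume t: "dist t 0 < e"
    \<comment> \<open>By \<open>abs_deg_ffact_le\<close> the series for \<open>- \<bar>lam\<bar>\<close>, \<open>\<bar>X\<bar>\<close> and \<open>\<bar>t\<bar>\<close> is a majorant;
      its sum is \<open>w = exp (s \<bar>X\<bar>)\<close>.\<close>
    define s where "s = ln (1 + - \<bar>lam\<bar> * \<bar>t\<bar>) / - \<bar>lam\<bar>"
    have small: "\<bar>- \<bar>lam\<bar> * \<bar>t\<bar>\<bar> < 1" "\<bar>s\<bar> < d"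
      using e(2)[of "\<bar>t\<bar>"] t by (auto simp: s_def)
    define w where "w \<omega> = exp (s * \<bar>X \<omega>\<bar>)" for \<omega>
    \<comment> \<open>Whatever the sign of \<open>X \<omega>\<close>, \<open>w \<omega>\<close> is
      one of these two summands.\<close>
    have "integrable M (\<lambda>\<omega>. exp (s * X \<omega>) + exp (- s * X \<omega>))"
      using d(2)[of s] d(2)[of "- s"] small(2) by (intro Bochner_Integration.integrable_add) auto
    then have w: "integrable M w"
    proof (rule Bochner_Integration.integrable_bound)
      show "AE \<omega> in M. norm (w \<omega>) \<le> norm (exp (s * X \<omega>) + exp (- s * X \<omega>))"
        unfolding real_norm_def abs_of_pos[OF add_pos_pos[OF exp_gt_zero exp_gt_zero]]
        by (intro AE_I2) (auto simp: w_def abs_real_def)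
    qed (simp add: w_def[abs_def])
    have maj: "(\<lambda>n. deg_ffact (- \<bar>lam\<bar>) \<bar>X \<omega>\<bar> n / fact n * \<bar>t\<bar> ^ n) sums w \<omega>" for \<omega>
      using deg_exp_sums[of "- \<bar>lam\<bar>" "\<bar>t\<bar>" "\<bar>X \<omega>\<bar>"] lam small(1)
      by (simp add: deg_exp_eq_exp w_def s_def abs_mult)
    define a where "a n \<omega> = deg_ffact lam (X \<omega>) n / fact n * t ^ n" for n \<omega>
    have le: "norm (a n \<omega>) \<le> deg_ffact (- \<bar>lam\<bar>) \<bar>X \<omega>\<bar> n / fact n * \<bar>t\<bar> ^ n" for n \<omega>
      unfolding a_def
      by (auto simp: abs_mult power_abs intro!: mult_right_mono divide_right_mono abs_deg_ffact_le)
    have nonneg: "0 \<le> deg_ffact (- \<bar>lam\<bar>) \<bar>X \<omega>\<bar> n / fact n * \<bar>t\<bar> ^ n" for n \<omega>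
      using order.trans[OF norm_ge_zero le] .
    \<comment> \<open>Used twice: singletons \<open>N\<close> make each term integrable, initial
      segments give the domination of the partial sums.\<close>
    have partial: "(\<Sum>n\<in>N. norm (a n \<omega>)) \<le> w \<omega>" if "finite N" for N \<omega>
    proof -
      have "(\<Sum>n\<in>N. norm (a n \<omega>)) \<le> (\<Sum>n\<in>N. deg_ffact (- \<bar>lam\<bar>) \<bar>X \<omega>\<bar> n / fact n * \<bar>t\<bar> ^ n)"
        by (intro sum_mono le)
      also have "\<dots> \<le> (\<Sum>n. deg_ffact (- \<bar>lam\<bar>) \<bar>X \<omega>\<bar> n / fact n * \<bar>t\<bar> ^ n)"
        using maj[of \<omega>] that nonneg by (intro sum_le_suminf) (auto simp: sums_iff)
      finally show ?thesis using maj[of \<omega>] by (simp add: sums_iff)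
    qed
    have a_meas[measurable]: "a n \<in> borel_measurable M" for n
      unfolding a_def[abs_def] by measurable
    have int: "integrable M (a n)" for n
      using w
    proof (rule Bochner_Integration.integrable_bound)
      show "AE \<omega> in M. norm (a n \<omega>) \<le> norm (w \<omega>)"
        using partial[of "{n}"] by (auto simp: w_def)
    qed measurable
    have "(\<lambda>N. \<integral>\<omega>. (\<Sum>n<N. a n \<omega>) \<partial>M) \<longlonglongrightarrow> (\<integral>\<omega>. deg_exp lam (X \<omega>) t \<partial>M)"
    proof (rule integral_dominated_convergence[OF _ _ w])
      show "AE \<omega> in M. (\<lambda>N. \<Sum>n<N. a n \<omega>) \<longlonglongrightarrow> deg_exp lam (X \<omega>) t"
        using deg_exp_sums[OF lam, of t] small(1)
        by (intro AE_I2) (simp add: a_def sums_def abs_mult)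
      show "AE \<omega> in M. norm (\<Sum>n<N. a n \<omega>) \<le> w \<omega>" for N
        using order.trans[OF norm_sum partial] by (intro AE_I2) auto
    qed measurable
    then have "(\<lambda>n. \<integral>\<omega>. a n \<omega> \<partial>M) sums (\<integral>\<omega>. deg_exp lam (X \<omega>) t \<partial>M)"
      using int by (simp add: sums_def)
    then show "(\<lambda>n. (\<integral>\<omega>. deg_ffact lam (X \<omega>) n \<partial>M) / fact n * t ^ n) sums
        (\<integral>\<omega>. deg_exp lam (X \<omega>) t \<partial>M)"
      by (simp add: a_def)
  qed (use e(1) in auto)
qed

section \<open>Sums of independent copies\<close>

text \<open>The exponential of the sum is a product of independent integrable factors, and each
  factor has the same expectation as \<open>exp (s * Y \<omega>)\<close> by transfer along the
  common law.\<close>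

lemma indep_copies_mgf:
  assumes "prob_space M" and Y[measurable]: "Y \<in> borel_measurable M" and "indep_copies M Y Yc"
    and int: "integrable M (\<lambda>\<omega>. exp (s * Y \<omega>))"
  shows "integrable M (\<lambda>\<omega>. exp (s * partial_sum Yc m \<omega>))"
    and "(\<integral>\<omega>. exp (s * partial_sum Yc m \<omega>) \<partial>M) = (\<integral>\<omega>. exp (s * Y \<omega>) \<partial>M) ^ m"
proof -
  interpret prob_space M by fact
  have indep: "indep_vars (\<lambda>_. borel) Yc {1..}"
    and distr: "\<And>j. j \<ge> 1 \<Longrightarrow> distr M borel (Yc j) = distr M borel Y"
    using assms(3) by (auto simp: indep_copies_def)
  have Yc: "Yc j \<in> borel_measurable M" if "j \<ge> 1" for j
    using indep that by (auto simp: indep_vars_def)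
  have int_copy: "integrable M (\<lambda>\<omega>. exp (s * Yc j \<omega>))"
    and eq_copy: "(\<integral>\<omega>. exp (s * Yc j \<omega>) \<partial>M) = (\<integral>\<omega>. exp (s * Y \<omega>) \<partial>M)" if "j \<ge> 1" for j
  proof -
    have e: "(\<lambda>y::real. exp (s * y)) \<in> borel_measurable borel" by measurable
    show "integrable M (\<lambda>\<omega>. exp (s * Yc j \<omega>))"
      using int distr[OF that] integrable_distr_eq[OF Y e] integrable_distr_eq[OF Yc[OF that] e]
      by simp
    show "(\<integral>\<omega>. exp (s * Yc j \<omega>) \<partial>M) = (\<integral>\<omega>. exp (s * Y \<omega>) \<partial>M)"
      using distr[OF that] integral_distr[OF Y e] integral_distr[OF Yc[OF that] e] by simp
  qed
  have "indep_vars (\<lambda>_. borel) Yc {1..m}"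
    by (rule indep_vars_subset[OF indep]) auto
  then have indep_exp: "indep_vars (\<lambda>_. borel) (\<lambda>j \<omega>. exp (s * Yc j \<omega>)) {1..m}"
    by (rule indep_vars_compose2[where Y="\<lambda>_ y. exp (s * y)"]) measurable
  have prod: "exp (s * partial_sum Yc m \<omega>) = (\<Prod>j = 1..m. exp (s * Yc j \<omega>))" for \<omega>
    by (simp add: partial_sum_def sum_distrib_left exp_sum)
  show "integrable M (\<lambda>\<omega>. exp (s * partial_sum Yc m \<omega>))"
    unfolding prod by (intro indep_vars_integrable indep_exp int_copy) auto
  have "(\<integral>\<omega>. exp (s * partial_sum Yc m \<omega>) \<partial>M) = (\<Prod>j = 1..m. \<integral>\<omega>. exp (s * Yc j \<omega>) \<partial>M)"
    unfolding prod by (intro indep_vars_lebesgue_integral indep_exp int_copy) auto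
  then show "(\<integral>\<omega>. exp (s * partial_sum Yc m \<omega>) \<partial>M) = (\<integral>\<omega>. exp (s * Y \<omega>) \<partial>M) ^ m"
    by (simp add: eq_copy)
qed

lemma borel_measurable_partial_sum:
  assumes "prob_space M" "indep_copies M Y Yc"
  shows "partial_sum Yc m \<in> borel_measurable M"
proof -
  interpret prob_space M by fact
  have "Yc j \<in> borel_measurable M" if "j \<ge> 1" for j
    using assms(2) that by (auto simp: indep_copies_def indep_vars_def)
  then show ?thesis
    unfolding partial_sum_def[abs_def] by (intro borel_measurable_sum) auto
qed

text \<open>The interval that works for \<open>Y\<close> works for every \<open>m\<close>.\<close>

lemma mgf_near_zero_partial_sum:
  assumes "prob_space M" "Y \<in> borel_measurable M" "mgf_near_zero M Y" "indep_copies M Y Yc"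
  shows "mgf_near_zero M (partial_sum Yc m)"
  using assms(3) indep_copies_mgf(1)[OF assms(1,2,4)] unfolding mgf_near_zero_def by blast

lemma eventually_integral_deg_exp_partial_sum:
  assumes "prob_space M" "lam \<noteq> 0" "Y \<in> borel_measurable M" "mgf_near_zero M Y"
    and "indep_copies M Y Yc"
  shows "\<forall>\<^sub>F t in nhds 0. (\<integral>\<omega>. deg_exp lam (partial_sum Yc m \<omega>) t \<partial>M) =
    (\<integral>\<omega>. deg_exp lam (Y \<omega>) t \<partial>M) ^ m"
proof -
  obtain d where d: "d > 0" "\<And>s. \<bar>s\<bar> < d \<Longrightarrow> integrable M (\<lambda>\<omega>. exp (s * Y \<omega>))"
    using assms(4) by (auto simp: mgf_near_zero_def)
  from eventually_ln_less[OF d(1) assms(2)] show ?thesis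
  proof eventually_elim
    case (elim t)
    then have "0 < 1 + lam * t" by linarith
    then show ?case
      using indep_copies_mgf(2)[OF assms(1,3,5) d(2), of "ln (1 + lam * t) / lam" m] elim
      by (simp add: deg_exp_eq_exp)
  qed
qed

section \<open>Comparison of coefficients\<close>

theorem theorem2p1:
  fixes M :: "'a measure" and Y :: "'a \<Rightarrow> real" and Yc :: "nat \<Rightarrow> 'a \<Rightarrow> real"
    and lam :: real and n k r :: nat
  assumes "prob_space M"
    and "lam \<noteq> 0"
    and "Y \<in> borel_measurable M"
    and "mgf_near_zero M Y"
    and "indep_copies M Y Yc"
    and "k \<le> n"
  shows "prob_deg_rStirling2 M Y Yc lam r (n + r) (k + r) =
    1 / fact k * (\<Sum>j=0..k. real (k choose j) * (-1) ^ (k - j) *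
      (\<integral>\<omega>. deg_ffact lam (partial_sum Yc (j + r) \<omega>) n \<partial>M))"
proof -
  interpret prob_space M by fact
  define \<phi> where "\<phi> t = (\<integral>\<omega>. deg_exp lam (Y \<omega>) t \<partial>M)" for t
  define \<Phi> where "\<Phi> = Abs_fps (\<lambda>n. (\<integral>\<omega>. deg_ffact lam (Y \<omega>) n \<partial>M) / fact n)"
  note S_power = eventually_integral_deg_exp_partial_sum[OF assms(1-5)]
  have \<phi>: "\<phi> has_fps_expansion \<Phi>"
    unfolding \<phi>_def[abs_def] \<Phi>_def by (intro integral_deg_exp_has_fps_expansion assms)
  \<comment> \<open>The function \<phi>^m has two expansions, the formal power of
    \<open>\<Phi>\<close> and the moment series of the partial sum; uniqueness identifies
    them.\<close>
  have \<Phi>_power: "fps_nth (\<Phi> ^ m) n = (\<integral>\<omega>. deg_ffact lam (partial_sum Yc m \<omega>) n \<partial>M) / fact n"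
    for m n
  proof -
    have "(\<lambda>t. \<phi> t ^ m) has_fps_expansion
        Abs_fps (\<lambda>n. (\<integral>\<omega>. deg_ffact lam (partial_sum Yc m \<omega>) n \<partial>M) / fact n)"
    proof (subst has_fps_expansion_cong[OF _ refl])
      show "\<forall>\<^sub>F t in nhds 0. \<phi> t ^ m = (\<integral>\<omega>. deg_exp lam (partial_sum Yc m \<omega>) t \<partial>M)"
        using S_power[of m] by eventually_elim (simp add: \<phi>_def)
    qed (intro integral_deg_exp_has_fps_expansion assms(2) borel_measurable_partial_sum[OF assms(1,5)]
        mgf_near_zero_partial_sum[OF assms(1,3,4,5)])
    from fps_expansion_unique_real[OF has_fps_expansion_power[OF \<phi>] this]
    show ?thesis by simp
  qed
  define G where "G = fps_const (1 / fact k) * (\<Phi> - 1) ^ k * \<Phi> ^ r"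
  have "(\<lambda>t. 1 / fact k * (\<phi> t - 1) ^ k * \<phi> t ^ r) has_fps_expansion G"
    unfolding G_def
    by (intro has_fps_expansion_mult has_fps_expansion_const has_fps_expansion_power
        has_fps_expansion_diff has_fps_expansion_1 \<phi>)
  moreover have "\<forall>\<^sub>F t in nhds 0. 1 / fact k * (\<phi> t - 1) ^ k * \<phi> t ^ r =
      prob_deg_rStirling2_gf M Y Yc lam r k t"
    using S_power[of r] by eventually_elim (simp add: prob_deg_rStirling2_gf_def \<phi>_def)
  ultimately have gf: "prob_deg_rStirling2_gf M Y Yc lam r k has_fps_expansion G"
    by (subst (asm) has_fps_expansion_cong[OF _ refl])
  \<comment> \<open>The constant term of \<open>\<Phi>\<close> is the expectation of the empty
    product, hence 1 by total mass 1.\<close>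
  have "fps_nth (\<Phi> - 1) 0 = 0"
    by (simp add: \<Phi>_def deg_ffact_def prob_space)
  then have "fps_nth ((\<Phi> - 1) ^ k) i = 0" if "i < k" for i
    using startsby_zero_power_prefix that by blast
  then have low: "fps_nth G i = 0" if "i < k" for i
    using that by (simp add: G_def mult.assoc fps_mult_nth)
  \<comment> \<open>Absorbing \<open>\<Phi> ^ r\<close> into the binomial sum produces the index
    \<open>j + r\<close> of the partial sums.\<close>
  have "(\<Phi> - 1) ^ k * \<Phi> ^ r = (\<Sum>j\<le>k. of_nat (k choose j) * \<Phi> ^ j * (- 1) ^ (k - j)) * \<Phi> ^ r"
    using binomial_ring[of \<Phi> "- 1" k] by simp
  also have "\<dots> = (\<Sum>j = 0..k. fps_const (real (k choose j) * (- 1) ^ (k - j)) * \<Phi> ^ (j + r))"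
    by (simp add: sum_distrib_left atMost_atLeast0 power_add mult_ac fps_of_nat
        flip: fps_const_mult fps_const_power fps_const_neg)
  finally have "fps_nth G n = 1 / fact k * (\<Sum>j = 0..k. real (k choose j) * (- 1) ^ (k - j) *
      ((\<integral>\<omega>. deg_ffact lam (partial_sum Yc (j + r) \<omega>) n \<partial>M) / fact n))"
    by (simp add: G_def mult.assoc fps_sum_nth \<Phi>_power)
  moreover have "prob_deg_rStirling2 M Y Yc lam r (n + r) (k + r) = fact n * fps_nth G n"
    by (simp add: prob_deg_rStirling2_def egf_coeffs_from_eqI[OF gf low])
  ultimately show ?thesis
    by (simp add: sum_distrib_left mult_ac)
qed

end
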